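(* Every solvable Lie algebra over $\mathbb K=\mathbb R$ or $\mathbb C$ of dimension $\leq 6$ is $T^*$-solitary. In particular, every ad-invariant metric on a solvable Lie algebra of dimension $\leq 6$ is solitary.
   Context: A metric on a Lie algebra $\mathfrak g$ is a nondegenerate symmetric $\mathbb K$-bilinear form $g$; it is ad-invariant if $g([X,Y],Z)=-g(Y,[X,Z])$ for all $X,Y,Z\in\mathfrak g$. A linear map $\phi\colon\mathfrak g\to\mathfrak g$ is ad-invariant if $\phi([X,Y])=[X,\phi(Y)]$ for all $X,Y$. For a linear map $f$, $f^{*_g}$ denotes its adjoint with respect to $g$. An ad-invariant metric $g$ is solitary if every ad-invariant $g$-self-adjoint linear map $\phi\colon\mathfrak g\to\mathfrak g$ can be written as $\phi=D+D^{*_g}$ for some derivation $D$ of $\mathfrak g$. For a linear map $\phi\colon\mathfrak g\to\mathfrak g^*$: its transpose is ${}^t\phi\colon\mathfrak g\to\mathfrak g^*$, ${}^t\phi(X)(Y)=\phi(Y)(X)$; $\phi$ is symmetric if $\phi={}^t\phi$; $\phi$ is ad-invariant if $\phi([X,Y])(Z)=-\phi(Y)([X,Z])$ for all $X,Y,Z\in\mathfrak g$. A linear map $D\colon\mathfrak g\to\mathfrak g^*$ is a derivation if $D([X,Y])(Z)=D(X)([Y,Z])-D(Y)([X,Z])$ for all $X,Y,Z\in\mathfrak g$. $\mathfrak g$ is $T^*$-solitary if every ad-invariant symmetric linear map $\phi\colon\mathfrak g\to\mathfrak g^*$ can be written as $\phi=D+{}^tD$ for some derivation $D\colon\mathfrak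 g\to\mathfrak g^*$. *)

theory Defs
  imports Complex_Main
begin

locale lie_algebra = vector_space scale
  for scale :: "'k::field \<Rightarrow> 'g::ab_group_add \<Rightarrow> 'g" (infixr "*s" 75) +
  fixes bracket :: "'g \<Rightarrow> 'g \<Rightarrow> 'g"
  assumes bracket_linear_left: "Vector_Spaces.linear scale scale (\<lambda>X. bracket X Y)"
    and bracket_linear_right: "Vector_Spaces.linear scale scale (bracket X)"
    and bracket_alternating: "bracket X X = 0"
    and jacobi: "bracket X (bracket Y Z) + bracket Y (bracket Z X) + bracket Z (bracket X Y) = 0"
begin

primrec derived_series :: "nat \<Rightarrow> 'g set" where
  "derived_series 0 = UNIV"
| "derived_series (Suc n) = span {bracket X Y | X Y. X \<in> derived_series n \<and> Y \<in> derived_series n}"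

definition solvable :: bool where
  "solvable \<longleftrightarrow> (\<exists>n. derived_series n = {0})"

abbreviation linear_endo :: "('g \<Rightarrow> 'g) \<Rightarrow> bool" where
  "linear_endo \<equiv> Vector_Spaces.linear scale scale"

definition bilinear_form :: "('g \<Rightarrow> 'g \<Rightarrow> 'k) \<Rightarrow> bool" where
  "bilinear_form b \<longleftrightarrow>
     (\<forall>X. Vector_Spaces.linear scale (*) (b X)) \<and>
     (\<forall>Y. Vector_Spaces.linear scale (*) (\<lambda>X. b X Y))"

definition metric :: "('g \<Rightarrow> 'g \<Rightarrow> 'k) \<Rightarrow> bool" where
  "metric g \<longleftrightarrow> bilinear_form g \<and> (\<forall>X Y. g X Y = g Y X) \<and>
     (\<forall>X. (\<forall>Y. g X Y = 0) \<longrightarrow> X = 0)"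

definition ad_invariant_metric :: "('g \<Rightarrow> 'g \<Rightarrow> 'k) \<Rightarrow> bool" where
  "ad_invariant_metric g \<longleftrightarrow> metric g \<and>
     (\<forall>X Y Z. g (bracket X Y) Z = - g Y (bracket X Z))"

definition ad_invariant_endo :: "('g \<Rightarrow> 'g) \<Rightarrow> bool" where
  "ad_invariant_endo \<phi> \<longleftrightarrow> (\<forall>X Y. \<phi> (bracket X Y) = bracket X (\<phi> Y))"

text \<open>Meaningful only when \<open>g\<close> is a metric and the space is finite-dimensional,
  so that the adjoint exists and is unique.\<close>
definition adjoint_wrt :: "('g \<Rightarrow> 'g \<Rightarrow> 'k) \<Rightarrow> ('g \<Rightarrow> 'g) \<Rightarrow> 'g \<Rightarrow> 'g" where
  "adjoint_wrt g f = (THE h. \<forall>X Y. g (f X) Y = g X (h Y))"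

definition derivation :: "('g \<Rightarrow> 'g) \<Rightarrow> bool" where
  "derivation D \<longleftrightarrow> linear_endo D \<and>
     (\<forall>X Y. D (bracket X Y) = bracket (D X) Y + bracket X (D Y))"

definition solitary :: "('g \<Rightarrow> 'g \<Rightarrow> 'k) \<Rightarrow> bool" where
  "solitary g \<longleftrightarrow>
     (\<forall>\<phi>. linear_endo \<phi> \<and> ad_invariant_endo \<phi> \<and> adjoint_wrt g \<phi> = \<phi> \<longrightarrow>
        (\<exists>D. derivation D \<and> \<phi> = (\<lambda>X. D X + adjoint_wrt g D X)))"

text \<open>A linear map from the Lie algebra to its dual is represented in curried form
  \<open>\<phi> X Y = \<phi>(X)(Y)\<close>: linearity of each \<open>\<phi> X\<close> says that the values lie in the dual space,
  and linearity in the first argument is linearity of the map itself.\<close>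

abbreviation linear_to_dual :: "('g \<Rightarrow> 'g \<Rightarrow> 'k) \<Rightarrow> bool" where
  "linear_to_dual \<equiv> bilinear_form"

definition dual_transpose :: "('g \<Rightarrow> 'g \<Rightarrow> 'k) \<Rightarrow> 'g \<Rightarrow> 'g \<Rightarrow> 'k" where
  "dual_transpose \<phi> = (\<lambda>X Y. \<phi> Y X)"

definition ad_invariant_to_dual :: "('g \<Rightarrow> 'g \<Rightarrow> 'k) \<Rightarrow> bool" where
  "ad_invariant_to_dual \<phi> \<longleftrightarrow> (\<forall>X Y Z. \<phi> (bracket X Y) Z = - \<phi> Y (bracket X Z))"

definition derivation_to_dual :: "('g \<Rightarrow> 'g \<Rightarrow> 'k) \<Rightarrow> bool" where
  "derivation_to_dual D \<longleftrightarrow> linear_to_dual D \<and>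
     (\<forall>X Y Z. D (bracket X Y) Z = D X (bracket Y Z) - D Y (bracket X Z))"

definition T_star_solitary :: bool where
  "T_star_solitary \<longleftrightarrow>
     (\<forall>\<phi>. linear_to_dual \<phi> \<and> ad_invariant_to_dual \<phi> \<and> \<phi> = dual_transpose \<phi> \<longrightarrow>
        (\<exists>D. derivation_to_dual D \<and> \<phi> = (\<lambda>X Y. D X Y + dual_transpose D X Y)))"

lemma adjoint_wrt_eqI:
  assumes g: "metric g" and h: "\<And>X Y. g (f X) Y = g X (h Y)"
  shows "adjoint_wrt g f = h"
  unfolding adjoint_wrt_def
proof (rule the_equality)
  show "\<forall>X Y. g (f X) Y = g X (h Y)" using h by blast
next
  fix k assume k: "\<forall>X Y. g (f X) Y = g X (k Y)"
  show "k = h"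
  proof
    fix Y
    have "g (k Y - h Y) X = 0" for X
    proof -
      have "Vector_Spaces.linear scale (*) (g X)"
        using g by (simp add: metric_def bilinear_form_def)
      then have "g X (k Y - h Y) = g X (k Y) - g X (h Y)"
        by (rule module_hom.diff[OF Vector_Spaces.linear.axioms(3)])
      then show ?thesis using g h k by (simp add: metric_def)
    qed
    then have "k Y - h Y = 0" using g unfolding metric_def by blast
    then show "k Y = h Y" by simp
  qed
qed

end

end

theory Submission imports Defs begin

text \<open>
  A symmetric invariant form \<open>\<phi>\<close> has a symmetrized derivation \<open>D + \<^sup>tD = \<phi>\<close> iff its Cartan 3-form
  \<open>\<omega>(X,Y,Z) = \<phi>([X,Y],Z)\<close> is exact: the skew part of \<open>D\<close> is a primitive of \<open>\<omega>/2\<close> up to sign.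
  If \<open>\<alpha>\<close> is a functional that vanishes on \<open>[g,g]\<close> and \<open>\<omega> = 0\<close> on its kernel, then
  \<open>\<omega> = \<alpha> \<and> \<iota>\<^sub>e\<omega> = d(\<alpha> \<and> \<phi>(e))\<close> for any \<open>e\<close> with \<open>\<alpha>(e) = 1\<close>, so it suffices to find such
  an \<open>\<alpha>\<close>.

  The radical of \<open>\<omega>\<close> is the ideal \<open>R = [g,g]\<^sup>\<bottom>\<close>, of codimension at most \<open>dim [g,g] \<le> 5\<close>, and if
  \<open>R \<noteq> g\<close> then solvability provides a nonzero \<open>\<alpha>\<close> vanishing on \<open>[g,g] + R\<close>. If \<open>dim [g,g] \<le> 4\<close>,
  then \<open>R\<close> has codimension at most 3, because a 3-form in four variables is degenerate; so \<open>ker \<alpha>\<close> is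
  spanned by \<open>R\<close> and two vectors, and \<open>\<omega>\<close> vanishes on it. If \<open>dim [g,g] = 5\<close> and \<open>\<omega> \<noteq> 0\<close> on
  \<open>h = [g,g] = ker \<alpha>\<close>, then a dimension count shows that \<open>\<omega>\<close> is a volume form on a 3-dimensional
  quotient \<open>h/r\<close>, which contains a plane \<open>k/r\<close> with \<open>[h,h] \<subseteq> k\<close> on which \<open>\<phi>\<close> is nondegenerate.
  Then \<open>ad e\<close> has trace 0 on \<open>h/r\<close> (it preserves \<open>\<omega>\<close>) and on \<open>k/r\<close> (it is skew), hence it vanishes
  on \<open>h/k\<close> and \<open>[g,g] \<subseteq> k\<close>, a contradiction.
\<close>

section \<open>Linear algebra: generators modulo a subspace, functionals and dimension
  counts\<close>

context finite_dimensional_vector_space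
begin

lemma subset_span_if_dim_le:
  assumes "dim V \<le> dim S" "S \<subseteq> V"
  shows "V \<subseteq> span S"
proof -
  have "span S = span V"
    using assms by (intro subspace_dim_equal) (auto simp: span_mono)
  then show ?thesis using span_superset[of V] by simp
qed

text \<open>If \<open>S\<close> already spans \<open>V\<close>, the choice \<open>p = 0\<close>
  serves. Hence the lemma can be iterated on upper bounds for the codimension, without a case split
  on its exact value.\<close>

lemma extend_by_one:
  assumes "0 \<in> V" "dim V \<le> dim S + Suc n"
  shows "\<exists>p\<in>V. dim V \<le> dim (insert p S) + n"
proof (cases "V \<subseteq> span S")
  case True
  then have "dim V \<le> dim S" by (rule dim_mono)
  also have "\<dots> \<le> dim (insert 0 S)" by (rule dim_subset) auto
  finally show ?thesis using assms(1) by (meson trans_le_add1)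
next
  case False
  then obtain p where "p \<in> V" "p \<notin> span S" by auto
  then show ?thesis using assms(2) by (intro bexI[of _ p]) (auto simp: dim_insert)
qed

lemma subset_span_insert_two:
  assumes "subspace V" "S \<subseteq> V" "dim V \<le> dim S + 2"
  obtains p q where "p \<in> V" "q \<in> V" "V \<subseteq> span (insert p (insert q S))"
proof -
  have 0: "0 \<in> V" using assms(1) by (rule subspace_0)
  obtain q where q: "q \<in> V" "dim V \<le> dim (insert q S) + 1"
    using extend_by_one[OF 0, of S 1] assms(3) by auto
  obtain p where p: "p \<in> V" "dim V \<le> dim (insert p (insert q S)) + 0"
    using extend_by_one[OF 0, of "insert q S" 0] q(2) by auto
  have "V \<subseteq> span (insert p (insert q S))"
    using p q assms(2) by (intro subset_span_if_dim_le) auto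
  then show thesis using that p(1) q(1) by blast
qed

lemma subset_span_insert_four:
  assumes "subspace V" "S \<subseteq> V" "dim V \<le> dim S + 4"
  obtains a b c d where "{a, b, c, d} \<subseteq> V" "V \<subseteq> span (insert a (insert b (insert c (insert d S))))"
proof -
  have 0: "0 \<in> V" using assms(1) by (rule subspace_0)
  obtain d where d: "d \<in> V" "dim V \<le> dim (insert d S) + 3"
    using extend_by_one[OF 0, of S 3] assms(3) by auto
  obtain c where c: "c \<in> V" "dim V \<le> dim (insert c (insert d S)) + 2"
    using extend_by_one[OF 0, of "insert d S" 2] d(2) by auto
  have "insert c (insert d S) \<subseteq> V" using c d assms(2) by auto
  from subset_span_insert_two[OF assms(1) this c(2)] 
  obtain a b where "a \<in> V" "b \<in> V" "V \<subseteq> span (insert a (insert b (insert c (insert d S))))"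
    by blast
  then show thesis using that c d by blast
qed

text \<open>A basis of \<open>S\<close> is extended to one of the whole space;
  \<open>\<alpha>\<close> is the coordinate along an added basis vector \<open>e\<close>.\<close>

lemma functional_vanishing_on:
  assumes "subspace S" "S \<noteq> UNIV"
  obtains \<alpha> e where "Vector_Spaces.linear scale (*) \<alpha>" "\<alpha> e = 1" "\<And>x. x \<in> S \<Longrightarrow> \<alpha> x = 0"
    "dim {x. \<alpha> x = 0} + 1 = dim UNIV"
proof -
  obtain C where C: "C \<subseteq> S" "independent C" "S \<subseteq> span C"
    using maximal_independent_subset[of S] by auto
  obtain B where B: "C \<subseteq> B" "independent B" "UNIV \<subseteq> span B"
    using maximal_independent_subset_extend[of C UNIV] C by auto
  have spB: "span B = UNIV" using B(3) by auto
  have "span C \<noteq> UNIV" using C(1) assms span_minimal by blast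
  then have "B \<noteq> C" using spB by auto
  then obtain e where e: "e \<in> B" "e \<notin> C" using B(1) by auto
  define \<alpha> where "\<alpha> = (\<lambda>x. representation B x e)"
  have lin: "Vector_Spaces.linear scale (*) \<alpha>"
    unfolding \<alpha>_def using B(2) spB
    by unfold_locales (auto simp: representation_add representation_scale algebra_simps)
  have e1: "\<alpha> e = 1"
    unfolding \<alpha>_def using representation_basis[OF B(2) e(1)] by simp
  have \<alpha>C: "\<alpha> x = 0" if "x \<in> C" for x
    unfolding \<alpha>_def using representation_basis[OF B(2), of x] that e B(1) by auto
  interpret \<alpha>: Vector_Spaces.linear scale "(*)" \<alpha> by (rule lin)
  have sub: "subspace {x. \<alpha> x = 0}" by (rule \<alpha>.subspace_kernel)
  have "span C \<subseteq> {x. \<alpha> x = 0}"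
    using \<alpha>C sub by (intro span_minimal) auto
  then have S: "\<alpha> x = 0" if "x \<in> S" for x using that C(3) by auto
  have en: "e \<notin> span {x. \<alpha> x = 0}"
    using sub e1 by (auto simp: span_eq_iff[THEN iffD2])
  have "span (insert e {x. \<alpha> x = 0}) = UNIV"
  proof -
    have "x \<in> span (insert e {x. \<alpha> x = 0})" for x
    proof -
      have "\<alpha> (x - \<alpha> x *s e) = 0" by (simp add: \<alpha>.diff \<alpha>.scale e1)
      then show ?thesis unfolding span_insert by (auto intro!: exI[of _ "\<alpha> x"] span_base)
    qed
    then show ?thesis by auto
  qed
  then have "dim UNIV = dim (insert e {x. \<alpha> x = 0})" by (metis dim_span)
  then have "dim {x. \<alpha> x = 0} + 1 = dim UNIV" using en by (simp add: dim_insert)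
  then show thesis using that lin e1 S by blast
qed

lemma dim_le_dim_kernel:
  assumes V: "subspace V" and lin: "Vector_Spaces.linear scale (*) l"
  shows "dim V \<le> dim {x \<in> V. l x = 0} + 1"
proof (cases "\<forall>x\<in>V. l x = 0")
  case True
  then have "{x \<in> V. l x = 0} = V" by auto
  then show ?thesis by simp
next
  case False
  then obtain v where v: "v \<in> V" "l v \<noteq> 0" by auto
  interpret l: Vector_Spaces.linear scale "(*)" l by (rule lin)
  have "V \<subseteq> span (insert v {x \<in> V. l x = 0})"
  proof
    fix x assume x: "x \<in> V"
    have "l (x - (l x / l v) *s v) = 0" using v by (simp add: l.diff l.scale)
    moreover have "x - (l x / l v) *s v \<in> V"
      using x v V by (simp add: subspace_diff subspace_scale)
    ultimately show "x \<in> span (insert v {x \<in> V. l x = 0})"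
      unfolding span_insert by (auto intro!: exI[of _ "l x / l v"] span_base)
  qed
  then have "dim V \<le> dim (insert v {x \<in> V. l x = 0})" by (rule dim_mono)
  then show ?thesis by (simp add: dim_insert split: if_splits)
qed

text \<open>Each \<open>w\<close> contributes one linear equation, and each equation lowers the
  dimension by at most one. Later bounds on orthogonal complements rest on this count.\<close>

lemma dim_le_dim_annihilated:
  assumes "finite W" and V: "subspace V"
    and lin: "\<And>w. w \<in> W \<Longrightarrow> Vector_Spaces.linear scale (*) (\<lambda>x. b x w)"
  shows "dim V \<le> dim {x \<in> V. \<forall>w\<in>W. b x w = 0} + card W"
  using assms(1) lin
proof (induction W rule: finite_induct)
  case empty
  then show ?case by simp
next
  case (insert w W)
  let ?U = "{x \<in> V. \<forall>w\<in>W. b x w = 0}"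
  have sub: "subspace ?U"
  proof (rule subspaceI)
    have h: "module_hom scale (*) (\<lambda>x. b x w)" if "w \<in> W" for w
      using insert.prems[of w] that by (simp add: Vector_Spaces.linear_iff_module_hom)
    show "0 \<in> ?U" using V module_hom.zero[OF h] by (auto simp: subspace_0)
    show "x + y \<in> ?U" if "x \<in> ?U" "y \<in> ?U" for x y
      using that V module_hom.add[OF h] by (auto simp: subspace_add)
    show "c *s x \<in> ?U" if "x \<in> ?U" for c x
      using that V module_hom.scale[OF h] by (auto simp: subspace_scale)
  qed
  have "dim V \<le> dim ?U + card W" using insert by auto
  moreover have "dim ?U \<le> dim {x \<in> ?U. b x w = 0} + 1"
    using sub insert.prems by (intro dim_le_dim_kernel) auto
  moreover have "{x \<in> ?U. b x w = 0} = {x \<in> V. \<forall>w\<in>insert w W. b x w = 0}" by auto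
  ultimately show ?case using insert.hyps by simp
qed

end

section \<open>Brackets, derived subspaces and solvability\<close>

context lie_algebra
begin

lemma bracket_add_left: "bracket (X + Y) Z = bracket X Z + bracket Y Z"
  and bracket_scale_left: "bracket (c *s X) Z = c *s bracket X Z"
  and bracket_diff_left: "bracket (X - Y) Z = bracket X Z - bracket Y Z"
  and bracket_zero_left: "bracket 0 Z = 0"
proof -
  interpret l: Vector_Spaces.linear scale scale "\<lambda>X. bracket X Z"
    by (rule bracket_linear_left)
  show "bracket (X + Y) Z = bracket X Z + bracket Y Z" by (rule l.add)
  show "bracket (c *s X) Z = c *s bracket X Z" by (rule l.scale)
  show "bracket (X - Y) Z = bracket X Z - bracket Y Z" by (rule l.diff)
  show "bracket 0 Z = 0" by (rule l.zero)
qed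

lemma bracket_add_right: "bracket Z (X + Y) = bracket Z X + bracket Z Y"
  and bracket_scale_right: "bracket Z (c *s X) = c *s bracket Z X"
  and bracket_diff_right: "bracket Z (X - Y) = bracket Z X - bracket Z Y"
  and bracket_zero_right: "bracket Z 0 = 0"
  and bracket_minus_right: "bracket Z (- X) = - bracket Z X"
proof -
  interpret l: Vector_Spaces.linear scale scale "bracket Z"
    by (rule bracket_linear_right)
  show "bracket Z (X + Y) = bracket Z X + bracket Z Y" by (rule l.add)
  show "bracket Z (c *s X) = c *s bracket Z X" by (rule l.scale)
  show "bracket Z (X - Y) = bracket Z X - bracket Z Y" by (rule l.diff)
  show "bracket Z 0 = 0" by (rule l.zero)
  show "bracket Z (- X) = - bracket Z X" by (rule l.neg)
qed

lemma bracket_anticomm: "bracket Y X = - bracket X Y"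
proof -
  have "bracket (X + Y) (X + Y) = bracket X X + bracket Y X + (bracket X Y + bracket Y Y)"
    by (simp only: bracket_add_left bracket_add_right)
  then have "bracket X Y + bracket Y X = 0"
    by (simp add: bracket_alternating add.commute)
  then show ?thesis by (simp add: eq_neg_iff_add_eq_0 add.commute)
qed

lemma bracket_derivation: 
  "bracket E (bracket X Y) = bracket (bracket E X) Y + bracket X (bracket E Y)"
proof -
  have "bracket E (bracket X Y) + bracket X (bracket Y E) + bracket Y (bracket E X) = 0"
    by (rule jacobi)
  moreover have "bracket X (bracket Y E) = - bracket X (bracket E Y)"
    using bracket_anticomm[of E Y] by (simp add: bracket_minus_right)
  moreover have "bracket Y (bracket E X) = - bracket (bracket E X) Y"
    by (rule bracket_anticomm)
  ultimately show ?thesis by (simp add: algebra_simps)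
qed

definition derived :: "'g set \<Rightarrow> 'g set" where
  "derived S = span {bracket X Y | X Y. X \<in> S \<and> Y \<in> S}"

lemma subspace_derived: "subspace (derived S)"
  by (simp add: derived_def)

lemma bracket_in_derived: "X \<in> S \<Longrightarrow> Y \<in> S \<Longrightarrow> bracket X Y \<in> derived S"
  unfolding derived_def by (rule span_base) blast

lemma derived_subset:
  assumes "\<And>X Y. X \<in> S \<Longrightarrow> Y \<in> S \<Longrightarrow> bracket X Y \<in> T" "subspace T"
  shows "derived S \<subseteq> T"
  unfolding derived_def using assms by (intro span_minimal) auto

text \<open>By the Leibniz rule \<open>bracket_derivation\<close>, \<open>ad E\<close> sends each
  generator of \<open>derived S\<close> to a sum of two generators.\<close>

lemma bracket_derived:
  assumes "\<And>X. X \<in> S \<Longrightarrow> bracket E X \<in> S" "X \<in> derived S"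
  shows "bracket E X \<in> derived S"
proof -
  have "derived S \<subseteq> {X. bracket E X \<in> derived S}"
  proof (rule derived_subset)
    show "bracket X Y \<in> {X. bracket E X \<in> derived S}" if "X \<in> S" "Y \<in> S" for X Y
      using that assms(1) bracket_derivation[of E X Y]
      by (simp add: subspace_add subspace_derived bracket_in_derived)
    show "subspace {X. bracket E X \<in> derived S}"
      using subspace_derived[of S]
      by (auto intro!: subspaceI simp: bracket_add_right bracket_scale_right bracket_zero_right
          subspace_add subspace_scale subspace_0)
  qed
  then show ?thesis using assms(2) by auto
qed

text \<open>A solvable Lie algebra \<open>S/R \<noteq> 0\<close> is not perfect.\<close>

lemma solvable_imp_subset_ideal:
  assumes solvable and S: "subspace S" and R: "subspace R" "R \<subseteq> S"
    and ideal: "\<And>X Y. X \<in> S \<Longrightarrow> Y \<in> R \<Longrightarrow> bracket X Y \<in> R"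
    and perfect: "S \<subseteq> span (derived S \<union> R)"
  shows "S \<subseteq> R"
proof -
  \<comment> \<open>Perfectness modulo \<open>R\<close> lets \<open>S\<close> descend the whole
    derived series; at the stage where the series is zero only \<open>R\<close> remains.\<close>
  have "S \<subseteq> span (derived_series n \<union> R)" for n
  proof (induction n)
    case 0
    then show ?case by (auto intro: span_base)
  next
    case (Suc n)
    let ?T = "span (derived_series (Suc n) \<union> R)"
    have D: "subspace (derived_series n)" by (cases n) auto
    have "derived S \<subseteq> ?T"
    proof (rule derived_subset)
      fix X Y assume X: "X \<in> S" and Y: "Y \<in> S"
      have split: "\<exists>d r. Z = d + r \<and> d \<in> derived_series n \<and> r \<in> R" if "Z \<in> S" for Z
        using Suc.IH that D R(1) unfolding span_Un by (auto simp: span_eq_iff[THEN iffD2])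
      obtain d r where d: "X = d + r" "d \<in> derived_series n" "r \<in> R" using split[OF X] by blast
      obtain d' r' where d': "Y = d' + r'" "d' \<in> derived_series n" "r' \<in> R"
        using split[OF Y] by blast
      \<comment> \<open>\<open>derived_series\<close> is that of the whole algebra and need not lie
        in \<open>S\<close>, so membership comes from \<open>d' = Y - r'\<close>. It is what makes
        the ideal property applicable to \<open>bracket d' r\<close>.\<close>
      have "d' \<in> S" using d' Y R S subspace_diff[OF S Y, of r'] by auto
      then have "bracket d' r \<in> R" using ideal d by auto
      then have "bracket r d' \<in> R"
        using bracket_anticomm[of r d'] R(1) by (simp add: subspace_neg)
      moreover have "bracket X r' \<in> R" using ideal X d' by auto
      moreover have "bracket d d' \<in> derived_series (Suc n)" using d d' by (auto intro: span_base)
      moreover have "bracket X Y = bracket d d' + bracket r d' + bracket X r'"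
        by (simp add: d(1) d'(1) bracket_add_left bracket_add_right algebra_simps)
      ultimately show "bracket X Y \<in> ?T"
        by (auto intro!: span_add intro: span_base)
    qed simp
    moreover have "R \<subseteq> ?T" by (auto intro: span_base)
    ultimately have "span (derived S \<union> R) \<subseteq> ?T" by (intro span_minimal) auto
    then show ?case using perfect by auto
  qed
  moreover obtain n where "derived_series n = {0}" using assms(1) unfolding solvable_def by auto
  ultimately have "S \<subseteq> span ({0} \<union> R)" by metis
  moreover have "{0} \<union> R = R" using R(1) subspace_0 by auto
  ultimately show ?thesis using R(1) by (simp add: span_eq_iff[THEN iffD2])
qed

end

section \<open>Invariant symmetric forms, the Cartan 3-form and its radicals\<close>

locale finite_dimensional_lie_algebra =
  lie_algebra scale bracket + finite_dimensional_vector_space scale Basis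
  for scale :: "'k::field \<Rightarrow> 'g::ab_group_add \<Rightarrow> 'g" (infixr "*s" 75)
    and bracket :: "'g \<Rightarrow> 'g \<Rightarrow> 'g" and Basis :: "'g set"

locale invariant_symmetric_form = finite_dimensional_lie_algebra scale bracket Basis
  for scale :: "'k::field \<Rightarrow> 'g::ab_group_add \<Rightarrow> 'g" (infixr "*s" 75)
    and bracket :: "'g \<Rightarrow> 'g \<Rightarrow> 'g" and Basis :: "'g set" +
  fixes \<phi> :: "'g \<Rightarrow> 'g \<Rightarrow> 'k"
  assumes bilinear: "bilinear_form \<phi>"
    and invariant: "\<phi> (bracket X Y) Z = - \<phi> Y (bracket X Z)"
    and symmetric: "\<phi> X Y = \<phi> Y X"
begin

lemma linear_right: "Vector_Spaces.linear scale (*) (\<phi> X)"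
  and linear_left: "Vector_Spaces.linear scale (*) (\<lambda>X. \<phi> X Y)"
  using bilinear by (auto simp: bilinear_form_def)

lemma form_right: "\<phi> Z (X + Y) = \<phi> Z X + \<phi> Z Y" "\<phi> Z (c *s X) = c * \<phi> Z X"
    "\<phi> Z (X - Y) = \<phi> Z X - \<phi> Z Y" "\<phi> Z 0 = 0" "\<phi> Z (- X) = - \<phi> Z X"
proof -
  interpret l: Vector_Spaces.linear scale "(*)" "\<phi> Z" by (rule linear_right)
  show "\<phi> Z (X + Y) = \<phi> Z X + \<phi> Z Y" "\<phi> Z (c *s X) = c * \<phi> Z X"
    "\<phi> Z (X - Y) = \<phi> Z X - \<phi> Z Y" "\<phi> Z 0 = 0" "\<phi> Z (- X) = - \<phi> Z X"
    by (rule l.add l.scale l.diff l.zero l.neg)+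
qed

lemma form_left: "\<phi> (X + Y) Z = \<phi> X Z + \<phi> Y Z" "\<phi> (c *s X) Z = c * \<phi> X Z"
    "\<phi> (X - Y) Z = \<phi> X Z - \<phi> Y Z" "\<phi> 0 Z = 0" "\<phi> (- X) Z = - \<phi> X Z"
  by (simp_all add: symmetric[of _ Z] form_right)

lemmas form_simps = form_left form_right bracket_add_left bracket_add_right
  bracket_scale_left bracket_scale_right bracket_diff_left bracket_diff_right
  bracket_zero_left bracket_zero_right

lemma form_bracket_assoc: "\<phi> (bracket X Y) Z = \<phi> X (bracket Y Z)"
  using invariant[of Y X Z] bracket_anticomm[of X Y] by (simp add: form_left)

lemma form_bracket_self: "\<phi> (bracket E X) X = 0"
  by (simp add: form_bracket_assoc bracket_alternating form_right)

definition cartan :: "'g \<Rightarrow> 'g \<Rightarrow> 'g \<Rightarrow> 'k" where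
  "cartan X Y Z = \<phi> (bracket X Y) Z"

lemma cartan_simps:
  "cartan (X + X') Y Z = cartan X Y Z + cartan X' Y Z" "cartan (c *s X) Y Z = c * cartan X Y Z"
  "cartan (X - X') Y Z = cartan X Y Z - cartan X' Y Z" "cartan 0 Y Z = 0"
  "cartan X (Y + Y') Z = cartan X Y Z + cartan X Y' Z" "cartan X (c *s Y) Z = c * cartan X Y Z"
  "cartan X (Y - Y') Z = cartan X Y Z - cartan X Y' Z" "cartan X 0 Z = 0"
  "cartan X Y (Z + Z') = cartan X Y Z + cartan X Y Z'" "cartan X Y (c *s Z) = c * cartan X Y Z"
  "cartan X Y (Z - Z') = cartan X Y Z - cartan X Y Z'" "cartan X Y 0 = 0"
  by (simp_all add: cartan_def form_simps)

lemma cartan_alternating [simp]: "cartan X X Z = 0" "cartan X Y Y = 0" "cartan X Y X = 0"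
  by (simp_all add: cartan_def bracket_alternating form_left form_bracket_self)
     (simp add: symmetric[of _ X] form_bracket_assoc[symmetric] bracket_alternating form_left)

lemma cartan_swap: "cartan Y X Z = - cartan X Y Z" "cartan X Z Y = - cartan X Y Z"
proof -
  show "cartan Y X Z = - cartan X Y Z"
    using bracket_anticomm[of Y X] by (simp add: cartan_def form_left)
  have "cartan X (Y + Z) (Y + Z) =
      cartan X Y Y + cartan X Z Y + (cartan X Y Z + cartan X Z Z)"
    by (simp only: cartan_simps)
  then have "cartan X Y Z + cartan X Z Y = 0" by (simp add: add.commute)
  then show "cartan X Z Y = - cartan X Y Z" by (simp add: eq_neg_iff_add_eq_0 add.commute)
qed

lemma cartan_cyclic: "cartan Y Z X = cartan X Y Z"
  using cartan_swap(1)[of Y X Z] cartan_swap(2)[of Y X Z] by simp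

text \<open>The action of \<open>ad E\<close> annihilates the 3-form. On a 3-dimensional quotient
  where the form is a volume form this says that \<open>ad E\<close> has trace zero.\<close>

lemma cartan_invariant:
  "cartan (bracket E X) Y Z + cartan X (bracket E Y) Z + cartan X Y (bracket E Z) = 0"
  using invariant[of E "bracket X Y" Z] bracket_derivation[of E X Y]
  by (simp add: cartan_def form_left)

lemma cartan_vanishes_on_span:
  assumes "\<And>X Y Z. X \<in> S \<Longrightarrow> Y \<in> S \<Longrightarrow> Z \<in> S \<Longrightarrow> cartan X Y Z = 0"
    "X \<in> span S" "Y \<in> span S" "Z \<in> span S"
  shows "cartan X Y Z = 0"
proof -
  have 1: "cartan X Y Z = 0" if "X \<in> span S" "Y \<in> S" "Z \<in> S" for X Y Z
    using that(1) by (induction rule: span_induct_alt) (auto simp: cartan_simps assms(1) that)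
  have 2: "cartan X Y Z = 0" if "X \<in> span S" "Y \<in> span S" "Z \<in> S" for X Y Z
    using that(2) by (induction rule: span_induct_alt) (auto simp: cartan_simps 1 that)
  show ?thesis
    using assms(4) by (induction rule: span_induct_alt) (auto simp: cartan_simps 2 assms)
qed

text \<open>Three generators outside \<open>R\<close> are chosen from \<open>p\<close> and
  \<open>q\<close> only, so two of them coincide and the alternating form vanishes.\<close>

lemma cartan_vanishes_rank_two:
  assumes "V \<subseteq> span (insert p (insert q R))" "insert p (insert q R) \<subseteq> V"
    and "\<And>X Y Z. X \<in> R \<Longrightarrow> Y \<in> V \<Longrightarrow> Z \<in> V \<Longrightarrow> cartan X Y Z = 0"
    and "X \<in> V" "Y \<in> V" "Z \<in> V"
  shows "cartan X Y Z = 0"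
proof (rule cartan_vanishes_on_span)
  have R: "cartan X Y Z = 0" "cartan Y X Z = 0" "cartan Y Z X = 0"
    if "X \<in> R" "Y \<in> V" "Z \<in> V" for X Y Z
    using assms(3)[OF that] cartan_swap(1)[of Y X Z] cartan_cyclic[of Y Z X] by auto
  fix X Y Z
  assume XYZ: "X \<in> insert p (insert q R)" "Y \<in> insert p (insert q R)" "Z \<in> insert p (insert q R)"
  show "cartan X Y Z = 0"
  proof (cases "X \<in> R \<or> Y \<in> R \<or> Z \<in> R")
    case True
    have "X \<in> V" "Y \<in> V" "Z \<in> V" using XYZ assms(2) by auto
    then show ?thesis using True R by metis
  next
    case False
    then show ?thesis using XYZ by auto
  qed
qed (use assms in auto)

text \<open>The orthogonal of \<open>derived S\<close>, not of \<open>S\<close>, taken in the whole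
  algebra. By \<open>orth_cartan\<close>, \<open>S \<inter> orth S\<close> is the radical of
  \<open>cartan\<close> restricted to \<open>S\<close>.\<close>

definition orth :: "'g set \<Rightarrow> 'g set" where
  "orth S = {X. \<forall>Y\<in>derived S. \<phi> X Y = 0}"

lemma subspace_orth: "subspace (orth S)"
  by (auto intro!: subspaceI simp: orth_def form_left)

lemma orth_cartan: "X \<in> orth S \<longleftrightarrow> (\<forall>Y\<in>S. \<forall>Z\<in>S. cartan X Y Z = 0)"
proof
  assume "X \<in> orth S"
  then show "\<forall>Y\<in>S. \<forall>Z\<in>S. cartan X Y Z = 0"
    by (auto simp: orth_def cartan_def form_bracket_assoc bracket_in_derived)
next
  assume "\<forall>Y\<in>S. \<forall>Z\<in>S. cartan X Y Z = 0"
  then have "derived S \<subseteq> {Y. \<phi> X Y = 0}"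
    by (intro derived_subset)
       (auto intro!: subspaceI simp: cartan_def form_bracket_assoc form_right)
  then show "X \<in> orth S" by (auto simp: orth_def)
qed

lemma cartan_orth:
  assumes "X \<in> orth S" "Y \<in> S" "Z \<in> S"
  shows "cartan X Y Z = 0" "cartan Y X Z = 0" "cartan Y Z X = 0"
proof -
  show "cartan X Y Z = 0" using assms orth_cartan by blast
  then show "cartan Y X Z = 0" "cartan Y Z X = 0"
    using cartan_swap(1)[of Y X Z] cartan_cyclic[of Y Z X] by simp_all
qed

lemma bracket_orth:
  assumes "\<And>Y. Y \<in> S \<Longrightarrow> bracket E Y \<in> S" "X \<in> orth S"
  shows "bracket E X \<in> orth S"
  using assms(2) bracket_derived[OF assms(1)] by (auto simp: orth_def invariant)

text \<open>The vector \<open>x\<close> in the proof is the contraction of \<open>a \<and> b \<and> c \<and> d\<close> with the 3-form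
  \<open>cartan\<close>, hence lies in its radical.\<close>

lemma codim_orth_le_three_aux:
  assumes "UNIV \<subseteq> span (insert a (insert b (insert c (insert d (orth UNIV)))))"
    and nz: "cartan b c d \<noteq> 0"
  shows "dim (UNIV :: 'g set) \<le> dim (orth UNIV) + 3"
proof -
  let ?R = "orth UNIV"
  have R: "cartan X Y Z = 0" "cartan Y X Z = 0" "cartan Y Z X = 0" if "X \<in> ?R" for X Y Z
    using cartan_orth[OF that] by auto
  define x where "x = cartan b c d *s a - cartan a c d *s b + cartan a b d *s c - cartan a b c *s d"
  define S where "S = insert a (insert b (insert c (insert d ?R)))"
  have x_gen: "cartan x Y Z = 0" if "Y \<in> {a, b, c, d}" "Z \<in> {a, b, c, d}" for Y Z
    using that cartan_swap(1)[of a b] cartan_swap(1)[of a c] cartan_swap(1)[of a d]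
      cartan_swap(1)[of b c] cartan_swap(1)[of b d] cartan_swap(1)[of c d]
      cartan_swap(2)[of _ a b] cartan_swap(2)[of _ a c] cartan_swap(2)[of _ a d]
      cartan_swap(2)[of _ b c] cartan_swap(2)[of _ b d] cartan_swap(2)[of _ c d]
    by (elim insertE emptyE) (simp_all add: x_def cartan_simps)
  have x_S: "cartan x Y Z = 0" if "Y \<in> S" "Z \<in> S" for Y Z
  proof (cases "Y \<in> ?R \<or> Z \<in> ?R")
    case True
    then show ?thesis using R by metis
  next
    case False
    then show ?thesis using that by (intro x_gen) (auto simp: S_def)
  qed
  have 1: "cartan x Y Z = 0" if "Y \<in> span S" "Z \<in> S" for Y Z
    using that(1) by (induction rule: span_induct_alt) (auto simp: cartan_simps x_S that)
  have 2: "cartan x Y Z = 0" if "Y \<in> span S" "Z \<in> span S" for Y Z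
    using that(2) by (induction rule: span_induct_alt) (auto simp: cartan_simps 1 that)
  have span_S: "span S = UNIV" using assms(1) by (auto simp: S_def)
  then have "x \<in> ?R" using 2 by (simp add: orth_cartan)
  let ?T = "insert b (insert c (insert d ?R))"
  \<comment> \<open>As \<open>x\<close> lies in the radical and its coefficient at \<open>a\<close>
    is nonzero, \<open>a\<close> is redundant among the generators.\<close>
  have "cartan b c d *s a = x + cartan a c d *s b - cartan a b d *s c + cartan a b c *s d"
    by (simp add: x_def)
  also have "\<dots> \<in> span ?T"
    using \<open>x \<in> ?R\<close> by (intro span_add span_diff span_scale) (auto intro: span_base)
  finally have "(1 / cartan b c d) *s (cartan b c d *s a) \<in> span ?T" by (rule span_scale)
  then have "a \<in> span ?T" using nz by simp
  then have "span S = span ?T" unfolding S_def by (simp add: span_redundant)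
  then have "dim (UNIV :: 'g set) = dim ?T" using span_S dim_span by metis
  then show ?thesis by (simp add: dim_insert)
qed

text \<open>On four generators modulo the radical the form has four coefficients, one for each
  omitted generator. A nonzero coefficient makes the omitted generator redundant; if all vanish, so
  does the form.\<close>

lemma codim_orth_le_three:
  assumes "dim (UNIV :: 'g set) \<le> dim (orth UNIV) + 4"
  shows "dim (UNIV :: 'g set) \<le> dim (orth UNIV) + 3"
proof -
  let ?R = "orth UNIV"
  obtain a b c d where g: "UNIV \<subseteq> span (insert a (insert b (insert c (insert d ?R))))"
    by (rule subset_span_insert_four[OF subspace_UNIV subset_UNIV assms])
  consider "cartan b c d \<noteq> 0" | "cartan a c d \<noteq> 0" | "cartan a b d \<noteq> 0" | "cartan a b c \<noteq> 0"
    | "cartan b c d = 0" "cartan a c d = 0" "cartan a b d = 0" "cartan a b c = 0" by blast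
  then show ?thesis
  proof cases
    case 1
    then show ?thesis using codim_orth_le_three_aux[OF g] by blast
  next
    case 2
    have "insert a (insert b (insert c (insert d ?R))) = insert b (insert a (insert c (insert d ?R)))"
      by auto
    then show ?thesis using codim_orth_le_three_aux[of b a c d] g 2 by simp
  next
    case 3
    have "insert a (insert b (insert c (insert d ?R))) = insert c (insert a (insert b (insert d ?R)))"
      by auto
    then show ?thesis using codim_orth_le_three_aux[of c a b d] g 3 by simp
  next
    case 4
    have "insert a (insert b (insert c (insert d ?R))) = insert d (insert a (insert b (insert c ?R)))"
      by auto
    then show ?thesis using codim_orth_le_three_aux[of d a b c] g 4 by simp
  next
    case 5
    have R: "cartan X Y Z = 0" "cartan Y X Z = 0" "cartan Y Z X = 0" if "X \<in> ?R" for X Y Z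
      using cartan_orth[OF that] by auto
    have gen: "cartan X Y Z = 0" if "X \<in> {a, b, c, d}" "Y \<in> {a, b, c, d}" "Z \<in> {a, b, c, d}" for X Y Z
      using that 5 cartan_swap(1)[of a b] cartan_swap(1)[of a c] cartan_swap(1)[of a d]
      cartan_swap(1)[of b c] cartan_swap(1)[of b d] cartan_swap(1)[of c d]
      cartan_swap(2)[of _ a b] cartan_swap(2)[of _ a c] cartan_swap(2)[of _ a d]
      cartan_swap(2)[of _ b c] cartan_swap(2)[of _ b d] cartan_swap(2)[of _ c d]
      by (elim insertE emptyE) simp_all
    have "cartan X Y Z = 0" for X Y Z
    proof (rule cartan_vanishes_on_span)
      show "cartan X Y Z = 0" if "X \<in> insert a (insert b (insert c (insert d ?R)))"
        "Y \<in> insert a (insert b (insert c (insert d ?R)))"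
        "Z \<in> insert a (insert b (insert c (insert d ?R)))" for X Y Z
      proof (cases "X \<in> ?R \<or> Y \<in> ?R \<or> Z \<in> ?R")
        case True
        then show ?thesis using R by metis
      next
        case False
        then show ?thesis using that by (intro gen) auto
      qed
    qed (use g in auto)
    then have "?R = UNIV" by (auto simp: orth_cartan)
    then show ?thesis by simp
  qed
qed

text \<open>The case of one-dimensional abelianization, where \<open>derived UNIV\<close> is the only candidate for
  the kernel of \<open>\<alpha>\<close>.\<close>

lemma cartan_vanishes_on_derived:
  assumes solvable and e: "UNIV = span (insert e (derived UNIV))"
    and dim5: "dim (derived UNIV) \<le> 5"
    and z: "z \<in> derived UNIV" "z \<noteq> 0" "z \<in> orth UNIV"
    and XYZ: "X \<in> derived UNIV" "Y \<in> derived UNIV" "Z \<in> derived UNIV"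
  shows "cartan X Y Z = 0"
proof (rule ccontr)
  assume nz: "cartan X Y Z \<noteq> 0"
  \<comment> \<open>\<open>r\<close> is the radical of \<open>cartan\<close> on \<open>h\<close>.
    Adjoining \<open>z\<close> to \<open>[h,h]\<close> in \<open>k\<close> costs no equation in the
    count below, because all of \<open>h\<close> is orthogonal to \<open>z\<close>.\<close>
  define h where "h = derived UNIV"
  define h' where "h' = derived h"
  define r where "r = h \<inter> orth h"
  define k where "k = span (insert z h')"
  have sub: "subspace h" "subspace h'" "subspace r" "subspace k"
    by (simp_all add: h_def h'_def r_def k_def subspace_derived subspace_inter subspace_orth)
  have br_h: "bracket A B \<in> h" for A B
    by (simp add: h_def bracket_in_derived)
  have br_h': "bracket E A \<in> h'" if "A \<in> h'" for E A
    using bracket_derived[of h E A] that br_h by (auto simp: h'_def)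
  have br_r: "bracket E A \<in> r" if "A \<in> r" for E A
    using bracket_orth[of h E A] that br_h by (auto simp: r_def)
  have "h' \<subseteq> h"
    unfolding h'_def using br_h sub by (intro derived_subset) auto
  have zh: "\<phi> A z = 0" if "A \<in> h" for A
    using z(3) that symmetric[of z] by (auto simp: orth_def h_def)
  have zr: "z \<in> r"
    using z \<open>h' \<subseteq> h\<close> by (auto simp: r_def orth_def h_def h'_def)
  have kh: "k \<subseteq> h"
    unfolding k_def using z(1) \<open>h' \<subseteq> h\<close> sub by (intro span_minimal) (auto simp: h_def)
  have r_cartan: "cartan A B C = 0" "cartan B A C = 0" "cartan B C A = 0"
    if "A \<in> r" "B \<in> h" "C \<in> h" for A B C
    using cartan_orth[of A h B C] that by (auto simp: r_def)
  have rh: "r \<subseteq> h" by (auto simp: r_def)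
  have not_hr: "\<not> h \<subseteq> r"
    using nz XYZ r_cartan[of X Y Z] by (auto simp: h_def)
  \<comment> \<open>Solvability applied to the nonzero quotient \<open>h/r\<close>; this supplies a
    vector \<open>f\<close> of \<open>h\<close> outside \<open>k\<close>.\<close>
  have not_perfect: "\<not> h \<subseteq> span (h' \<union> r)"
    using solvable_imp_subset_ideal[OF \<open>solvable\<close> sub(1) sub(3) rh br_r] not_hr
    by (auto simp: h'_def)
  have k_sub: "k \<subseteq> span (h' \<union> r)"
    unfolding k_def using zr by (intro span_mono) auto
  obtain f where f: "f \<in> h" "f \<notin> k" using not_perfect k_sub by auto

  have dim_h_lower: "dim r + 3 \<le> dim h"
  proof (rule ccontr)
    assume "\<not> dim r + 3 \<le> dim h"
    then have "dim h \<le> dim r + 2" by simp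
    then obtain p q where pq: "p \<in> h" "q \<in> h" "h \<subseteq> span (insert p (insert q r))"
      using subset_span_insert_two[OF sub(1) rh] by blast
    have "cartan X Y Z = 0"
      by (rule cartan_vanishes_rank_two[OF pq(3)]) (use pq rh r_cartan XYZ in \<open>auto simp: h_def\<close>)
    then show False using nz by simp
  qed
  \<comment> \<open>A basis of \<open>k\<close> through \<open>z\<close>: a vector of
    \<open>h\<close> orthogonal to the other basis vectors is orthogonal to all of \<open>k\<close>,
    hence in \<open>r\<close>. So \<open>r\<close> has codimension at most \<open>dim k - 1\<close>
    in \<open>h\<close>.\<close>
  obtain B where B: "{z} \<subseteq> B" "B \<subseteq> k" "independent B" "k \<subseteq> span B"
    using maximal_independent_subset_extend[of "{z}" k] z(2)
    by (auto simp: k_def intro: span_base)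
  have finB: "finite B" using B(3) by (rule finiteI_independent)
  have "{A \<in> h. \<forall>w\<in>B - {z}. \<phi> A w = 0} \<subseteq> r"
  proof
    fix A assume A: "A \<in> {A \<in> h. \<forall>w\<in>B - {z}. \<phi> A w = 0}"
    then have "\<phi> A w = 0" if "w \<in> B" for w using that zh[of A] by (cases "w = z") auto
    then have "B \<subseteq> {w. \<phi> A w = 0}" by auto
    then have "span B \<subseteq> {w. \<phi> A w = 0}"
      by (rule span_minimal) (auto intro!: subspaceI simp: form_right)
    then have "h' \<subseteq> {w. \<phi> A w = 0}" using B(4) by (auto simp: k_def intro: span_base)
    then show "A \<in> r" using A by (auto simp: r_def orth_def h'_def)
  qed
  then have "dim {A \<in> h. \<forall>w\<in>B - {z}. \<phi> A w = 0} \<le> dim r" by (rule dim_subset)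
  moreover have "dim h \<le> dim {A \<in> h. \<forall>w\<in>B - {z}. \<phi> A w = 0} + card (B - {z})"
    using finB sub(1) linear_left by (intro dim_le_dim_annihilated) auto
  moreover have "card B = dim k" using B basis_card_eq_dim by blast
  moreover have "card B = card (B - {z}) + 1"
    using B(1) card.remove[OF finB, of z] by auto
  ultimately have dim_h_upper: "dim h + 1 \<le> dim r + dim k" by linarith
  have k_span: "span k = k" using sub(4) by simp
  have "dim (insert f k) \<le> dim h" using f kh by (intro dim_subset) auto
  then have "dim k + 1 \<le> dim h" using f(2) k_span by (simp add: dim_insert)
  \<comment> \<open>The lower and upper bounds on \<open>dim h - dim r\<close> force
    \<open>dim k \<ge> 4\<close>, while \<open>dim k < dim h \<le> 5\<close> forces
    \<open>dim k \<le> 4\<close>. All inequalities are therefore equalities.\<close>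
  then have dims: "dim k = 4" "dim h = 5" "dim r = 2"
    using dim_h_lower dim_h_upper dim5 by (auto simp: h_def)
  have hkf: "h \<subseteq> span (insert f k)"
    using f kh dims by (intro subset_span_if_dim_le) (auto simp: dim_insert k_span)
  \<comment> \<open>\<open>h' + r\<close> contains \<open>k\<close> and is a proper subspace of
    \<open>h\<close> by \<open>not_perfect\<close>, so it has dimension at most 4 and equals
    \<open>k\<close>.\<close>
  have r_k: "r \<subseteq> k"
  proof -
    let ?m = "span (h' \<union> r)"
    have mh: "?m \<subseteq> h" using \<open>h' \<subseteq> h\<close> rh sub by (intro span_minimal) auto
    have "dim ?m \<noteq> dim h"
    proof
      assume "dim ?m = dim h"
      then have "?m = h" using mh sub by (intro subspace_dim_equal) auto
      then show False using not_perfect by simp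
    qed
    moreover have "dim ?m \<le> dim h" using mh by (rule dim_subset)
    ultimately have "dim ?m \<le> dim k" using dims by linarith
    then have "?m \<subseteq> span k" using k_sub by (rule subset_span_if_dim_le)
    then show ?thesis using k_span by (auto intro: span_base)
  qed
  obtain u v where uv: "u \<in> k" "v \<in> k" "k \<subseteq> span (insert u (insert v r))"
    using subset_span_insert_two[OF sub(4) r_k] dims by auto
  have uvh: "u \<in> h" "v \<in> h" using uv kh by auto
  have k_cartan: "cartan A B C = 0" if "A \<in> k" "B \<in> k" "C \<in> k" for A B C
  proof (rule cartan_vanishes_rank_two[OF uv(3)])
    show "cartan A B C = 0" if "A \<in> r" "B \<in> k" "C \<in> k" for A B C
      using that kh by (intro r_cartan(1)) auto
  qed (use uv r_k that in auto)

  \<comment> \<open>\<open>f\<close>, \<open>u\<close>, \<open>v\<close> span \<open>h\<close>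
    modulo \<open>r\<close>, so this single value determines \<open>cartan\<close> on
    \<open>h\<close>.\<close>
  have omega: "cartan f u v \<noteq> 0"
  proof
    assume 0: "cartan f u v = 0"
    let ?S = "insert f (insert u (insert v r))"
    have gen: "cartan A B C = 0" if "A \<in> {f, u, v}" "B \<in> {f, u, v}" "C \<in> {f, u, v}" for A B C
      using that 0 cartan_swap(1)[of f u] cartan_swap(1)[of f v] cartan_swap(1)[of u v]
        cartan_swap(2)[of _ f u] cartan_swap(2)[of _ f v] cartan_swap(2)[of _ u v]
      by (elim insertE emptyE) simp_all
    have S: "cartan A B C = 0" if "A \<in> ?S" "B \<in> ?S" "C \<in> ?S" for A B C
    proof -
      have "A \<in> h" "B \<in> h" "C \<in> h" using that f uvh rh by auto
      show ?thesis
      proof (cases "A \<in> r \<or> B \<in> r \<or> C \<in> r")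
        case True
        then show ?thesis using r_cartan \<open>A \<in> h\<close> \<open>B \<in> h\<close> \<open>C \<in> h\<close> by metis
      next
        case False
        then show ?thesis using that by (intro gen) auto
      qed
    qed
    have "k \<subseteq> span ?S" using uv(3) span_mono[of "insert u (insert v r)" ?S] by auto
    then have "insert f k \<subseteq> span ?S" by (auto intro: span_base)
    then have "span (insert f k) \<subseteq> span ?S" by (rule span_minimal) simp
    then have "h \<subseteq> span ?S" using hkf by blast
    then have "X \<in> span ?S" "Y \<in> span ?S" "Z \<in> span ?S" using XYZ by (auto simp: h_def)
    with S have "cartan X Y Z = 0" by (rule cartan_vanishes_on_span)
    then show False using nz by simp
  qed

  have rk_orth: "\<phi> A C = 0" if "A \<in> r" "C \<in> k" for A C
  proof -
    have "insert z h' \<subseteq> {C. \<phi> A C = 0}"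
      using that(1) zh by (auto simp: r_def orth_def h'_def)
    then have "k \<subseteq> {C. \<phi> A C = 0}"
      unfolding k_def by (rule span_minimal) (auto intro!: subspaceI simp: form_right)
    then show ?thesis using that(2) by auto
  qed
  have k_cases: "\<exists>\<alpha> \<beta> \<rho>. C = \<alpha> *s u + \<beta> *s v + \<rho> \<and> \<rho> \<in> r" if C: "C \<in> k" for C
  proof -
    obtain \<alpha> where "C - \<alpha> *s u \<in> span (insert v r)" using uv(3) C span_breakdown_eq by blast
    then obtain \<beta> where \<beta>: "C - \<alpha> *s u - \<beta> *s v \<in> span r" using span_breakdown_eq by blast
    have "C = \<alpha> *s u + \<beta> *s v + (C - \<alpha> *s u - \<beta> *s v)" by simp
    then show ?thesis using \<beta> sub(3) by (metis span_eq_iff)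
  qed
  \<comment> \<open>This is the nondegeneracy of \<open>\<phi>\<close> on \<open>k/r\<close>:
    orthogonality to \<open>u\<close>, \<open>v\<close> and \<open>r\<close> gives orthogonality to
    \<open>k\<close>, which contains \<open>h'\<close>.\<close>
  have in_r: "A \<in> r" if "A \<in> k" "\<phi> A u = 0" "\<phi> A v = 0" for A
  proof -
    have "\<phi> A C = 0" if "C \<in> h'" for C
    proof -
      have "C \<in> k" using that by (auto simp: k_def intro: span_base)
      then obtain \<alpha> \<beta> \<rho> where "C = \<alpha> *s u + \<beta> *s v + \<rho>" "\<rho> \<in> r" using k_cases by blast
      then show ?thesis
        using \<open>\<phi> A u = 0\<close> \<open>\<phi> A v = 0\<close> rk_orth[of \<rho> A] \<open>A \<in> k\<close> symmetric[of A \<rho>]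
        by (simp add: form_right)
    qed
    then show ?thesis using \<open>A \<in> k\<close> kh by (auto simp: r_def orth_def h'_def)
  qed

  define p q s where "p = \<phi> u u" and "q = \<phi> u v" and "s = \<phi> v v"
  have vu: "\<phi> v u = q" by (simp add: q_def symmetric)
  have gram: "p * s - q * q \<noteq> 0"
  proof
    assume det: "p * s - q * q = 0"
    \<comment> \<open>Up to sign the coefficients are the columns of the adjugate of the Gram
      matrix, which map to zero when the determinant vanishes. Contracting with \<open>f\<close> and
      \<open>u\<close> then gives \<open>q = p = 0\<close>.\<close>
    have su: "s *s u - q *s v \<in> r" and qu: "q *s u - p *s v \<in> r"
      using det uv sub(4)
      by (intro in_r; simp add: form_left vu flip: p_def q_def s_def
          add: subspace_diff subspace_scale algebra_simps)+
    have "q * cartan f v u = 0"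
      using r_cartan(2)[OF su f(1) uvh(1)] by (simp add: cartan_simps)
    moreover have "p * cartan f v u = 0"
      using r_cartan(2)[OF qu f(1) uvh(1)] by (simp add: cartan_simps)
    ultimately have "q = 0" "p = 0"
      using omega cartan_swap(2)[of f v u] by auto
    then have "u \<in> r" using uv(1) by (intro in_r) (auto simp: p_def q_def)
    then show False using omega r_cartan(2)[of u f v] f uvh by simp
  qed

  have Ak: "bracket e C \<in> k" if "C \<in> k" for C
  proof -
    have "k \<subseteq> {C. bracket e C \<in> k}"
      unfolding k_def
    proof (rule span_minimal)
      \<comment> \<open>\<open>ad e\<close> sends \<open>z\<close> into \<open>r\<close>, which lies
        in \<open>k\<close> by \<open>r_k\<close>.\<close>
      show "insert z h' \<subseteq> {C. bracket e C \<in> span (insert z h')}"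
        using br_r[OF zr, of e] r_k br_h'[of _ e] by (auto simp: k_def intro: span_base)
      show "subspace {C. bracket e C \<in> span (insert z h')}"
        by (auto intro!: subspaceI simp: form_simps span_zero span_add span_scale)
    qed
    then show ?thesis using that by auto
  qed
  obtain a b \<rho> where Au: "bracket e u = a *s u + b *s v + \<rho>" "\<rho> \<in> r"
    using k_cases[OF Ak[OF uv(1)]] by blast
  obtain c d \<rho>' where Av: "bracket e v = c *s u + d *s v + \<rho>'" "\<rho>' \<in> r"
    using k_cases[OF Ak[OF uv(2)]] by blast
  obtain \<mu> where "bracket e f - \<mu> *s f \<in> span k" 
    using hkf br_h[of e f] span_breakdown_eq by blast
  then obtain \<kappa> where Af: "bracket e f = \<mu> *s f + \<kappa>" "\<kappa> \<in> k"
    using k_span by (metis add_diff_cancel_left' diff_add_cancel add.commute)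
  text \<open>\<open>ad e\<close> is skew on the nondegenerate plane \<open>k/r\<close>, so its trace there vanishes.\<close>
  have "a + d = 0"
  proof -
    have 1: "a * p + b * q = 0"
      using form_bracket_self[of e u] rk_orth[OF Au(2) uv(1)]
      by (simp add: Au form_left vu flip: p_def)
    have 2: "c * q + d * s = 0"
      using form_bracket_self[of e v] rk_orth[OF Av(2) uv(2)]
      by (simp add: Av form_left flip: q_def s_def)
    have "\<phi> (bracket e u) v + \<phi> (bracket e v) u = 0"
      using invariant[of e u v] symmetric[of u "bracket e v"] by simp
    then have 3: "a * q + b * s + c * p + d * q = 0"
      using rk_orth[OF Av(2) uv(1)] rk_orth[OF Au(2) uv(2)]
      by (simp add: Au Av form_left vu flip: p_def q_def s_def) (simp add: algebra_simps)
    \<comment> \<open>The three skewness relations are weighted so that \<open>b\<close> and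
      \<open>c\<close> cancel, leaving the trace times the Gram determinant.\<close>
    have "(a + d) * (p * s - q * q) =
      s * (a * p + b * q) + p * (c * q + d * s) - q * (a * q + b * s + c * p + d * q)"
      by (simp add: algebra_simps)
    then show ?thesis using gram by (simp add: 1 2 3)
  qed
  text \<open>\<open>ad e\<close> preserves the volume form \<open>cartan\<close> of \<open>h/r\<close>, so its trace vanishes there as well,
    and it acts by \<open>0\<close> on the line \<open>h/k\<close>.\<close>
  have "cartan (bracket e f) u v = \<mu> * cartan f u v"
    using k_cartan[OF Af(2) uv(1,2)] by (simp add: Af cartan_simps)
  moreover have "cartan f (bracket e u) v = a * cartan f u v"
    using r_cartan(2)[OF Au(2) f(1) uvh(2)] by (simp add: Au cartan_simps)
  moreover have "cartan f u (bracket e v) = d * cartan f u v"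
    using r_cartan(3)[OF Av(2) f(1) uvh(1)] by (simp add: Av cartan_simps)
  ultimately have "(\<mu> + (a + d)) * cartan f u v = 0"
    using cartan_invariant[of e f u v] by (simp add: algebra_simps)
  then have "\<mu> = 0" using omega \<open>a + d = 0\<close> by simp
  then have Aff: "bracket e f \<in> k" using Af by simp
  have Ah: "bracket e C \<in> k" if C: "C \<in> h" for C
  proof -
    obtain \<gamma> where "C - \<gamma> *s f \<in> k" using hkf C span_breakdown_eq k_span by blast
    then have "bracket e (C - \<gamma> *s f) + \<gamma> *s bracket e f \<in> k"
      using Ak Aff sub(4) by (simp add: subspace_add subspace_scale)
    then show ?thesis by (simp add: form_simps)
  qed
  have "h \<subseteq> k"
    unfolding h_def
  proof (rule derived_subset)
    fix A B
    have split: "\<exists>\<alpha> A'. A = \<alpha> *s e + A' \<and> A' \<in> h" for A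
    proof -
      obtain \<alpha> where "A - \<alpha> *s e \<in> span h" using e span_breakdown_eq[of A e h] by (auto simp: h_def)
      then show ?thesis using sub(1)
        by (metis add.commute diff_add_cancel span_eq_iff)
    qed
    obtain \<alpha> A' where A: "A = \<alpha> *s e + A'" "A' \<in> h" using split by blast
    obtain \<beta> B' where B: "B = \<beta> *s e + B'" "B' \<in> h" using split by blast
    have "bracket A' B' \<in> k"
      using A B by (auto simp: k_def h'_def intro!: span_base bracket_in_derived)
    moreover have "bracket A B = \<alpha> *s bracket e B' - \<beta> *s bracket e A' + bracket A' B'"
      using bracket_anticomm[of A' e] by (simp add: A B form_simps bracket_alternating)
    ultimately show "bracket A B \<in> k"
      using Ah A B sub(4) by (simp add: subspace_add subspace_diff subspace_scale)
  qed (rule sub)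
  then show False using f by auto
qed

section \<open>Factoring the Cartan form and constructing the derivation\<close>

lemma dim_le_dim_orth: "dim (UNIV :: 'g set) \<le> dim (orth UNIV) + dim (derived UNIV)"
proof -
  obtain B where B: "B \<subseteq> derived UNIV" "independent B" "derived UNIV \<subseteq> span B"
    "card B = dim (derived UNIV)"
    using basis_exists[of "derived UNIV"] by blast
  have "{X \<in> UNIV. \<forall>w\<in>B. \<phi> X w = 0} \<subseteq> orth UNIV"
  proof
    fix X assume "X \<in> {X \<in> UNIV. \<forall>w\<in>B. \<phi> X w = 0}"
    then have "B \<subseteq> {w. \<phi> X w = 0}" by auto
    then have "span B \<subseteq> {w. \<phi> X w = 0}"
      by (rule span_minimal) (auto intro!: subspaceI simp: form_right)
    then show "X \<in> orth UNIV" using B(3) by (auto simp: orth_def)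
  qed
  then have "dim {X \<in> UNIV. \<forall>w\<in>B. \<phi> X w = 0} \<le> dim (orth UNIV)" by (rule dim_subset)
  moreover have "dim (UNIV :: 'g set) \<le> dim {X \<in> UNIV. \<forall>w\<in>B. \<phi> X w = 0} + card B"
    using finiteI_independent[OF B(2)] linear_left by (intro dim_le_dim_annihilated) auto
  ultimately show ?thesis using B(4) by linarith
qed

text \<open>The formula writes out \<open>cartan\<close> as the wedge of \<open>\<alpha>\<close>
  with its contraction by \<open>e\<close>, since
  \<open>\<phi> e (bracket Y Z) = cartan e Y Z\<close>. The normalization
  \<open>\<alpha> e = 1\<close> stays inside the proof, so that \<open>\<alpha> = 0\<close> can
  serve when the form vanishes.\<close>

lemma cartan_divisible_by_closed_functional:
  assumes solvable and dim6: "dim (UNIV :: 'g set) \<le> 6"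
  obtains \<alpha> e where "Vector_Spaces.linear scale (*) \<alpha>" "\<And>X Y. \<alpha> (bracket X Y) = 0"
    "\<And>X Y Z. cartan X Y Z =
       \<alpha> X * \<phi> e (bracket Y Z) + \<alpha> Y * \<phi> e (bracket Z X) + \<alpha> Z * \<phi> e (bracket X Y)"
proof (cases "orth UNIV = UNIV")
  case True
  then have "cartan X Y Z = 0" for X Y Z using orth_cartan[of X UNIV] by auto
  moreover have "Vector_Spaces.linear scale (*) (\<lambda>_. 0)"
    by unfold_locales (auto simp: algebra_simps)
  ultimately show thesis using that[of "\<lambda>_. 0" 0] by simp
next
  case False
  define R where "R = orth UNIV"
  have brR: "bracket X Y \<in> R" if "Y \<in> R" for X Y
    using that bracket_orth by (auto simp: R_def)
  have subR: "subspace R" by (simp add: R_def subspace_orth)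
  have "\<not> UNIV \<subseteq> span (derived UNIV \<union> R)"
    using solvable_imp_subset_ideal[of UNIV R] \<open>solvable\<close> subR brR False
    by (auto simp: R_def)
  then have "span (derived UNIV \<union> R) \<noteq> UNIV" by auto
  then obtain \<alpha> e where \<alpha>: "Vector_Spaces.linear scale (*) \<alpha>" "\<alpha> e = 1"
    "\<And>x. x \<in> span (derived UNIV \<union> R) \<Longrightarrow> \<alpha> x = 0" "dim {x. \<alpha> x = 0} + 1 = dim (UNIV :: 'g set)"
    using functional_vanishing_on[OF subspace_span] by blast
  interpret \<alpha>: Vector_Spaces.linear scale "(*)" \<alpha> by (rule \<alpha>)
  define h where "h = {x. \<alpha> x = 0}"
  have subh: "subspace h" unfolding h_def by (rule \<alpha>.subspace_kernel)
  have dimh: "dim h + 1 = dim (UNIV :: 'g set)" using \<alpha>(4) by (simp add: h_def)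
  have Dh: "derived UNIV \<subseteq> h" and Rh: "R \<subseteq> h"
    using \<alpha>(3) by (auto simp: h_def intro: span_base)
  have h0: "cartan X Y Z = 0" if "X \<in> h" "Y \<in> h" "Z \<in> h" for X Y Z
  proof (cases "dim (derived UNIV) \<le> 4")
    case True
    then have "dim (UNIV :: 'g set) \<le> dim R + 3"
      using codim_orth_le_three dim_le_dim_orth by (auto simp: R_def)
    then have "dim h \<le> dim R + 2" using dimh by linarith
    then obtain p q where pq: "p \<in> h" "q \<in> h" "h \<subseteq> span (insert p (insert q R))"
      using subset_span_insert_two[OF subh Rh] by blast
    show ?thesis
    proof (rule cartan_vanishes_rank_two[OF pq(3)])
      show "cartan X Y Z = 0" if "X \<in> R" for X Y Z
        using that orth_cartan[of X UNIV] by (auto simp: R_def)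
    qed (use pq Rh that in auto)
  next
    case False
    then have "span (derived UNIV) = span h"
      using Dh dimh dim6 by (intro subspace_dim_equal) (auto simp: span_mono)
    then have hD: "h = derived UNIV" using subh subspace_derived by (metis span_eq_iff)
    have "e \<notin> span h" using \<alpha>(2) subh by (simp add: h_def span_eq_iff[THEN iffD2])
    then have "UNIV \<subseteq> span (insert e h)"
      using dimh by (intro subset_span_if_dim_le) (auto simp: dim_insert)
    then have gen: "UNIV = span (insert e (derived UNIV))" by (auto simp: hD)
    \<comment> \<open>The codimension of \<open>R\<close> is at most \<open>dim h\<close>, one less
      than the dimension of the algebra.\<close>
    have "dim R \<noteq> 0" using dim_le_dim_orth dimh unfolding R_def hD by linarith
    then obtain z where "z \<in> R" "z \<noteq> 0" by auto
    then show ?thesis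
      using cartan_vanishes_on_derived[OF \<open>solvable\<close> gen, of z X Y Z] that Rh dimh dim6
      by (auto simp: R_def hD)
  qed
  have "cartan X Y Z =
       \<alpha> X * \<phi> e (bracket Y Z) + \<alpha> Y * \<phi> e (bracket Z X) + \<alpha> Z * \<phi> e (bracket X Y)" for X Y Z
  proof -
    have split: "\<exists>W. V = \<alpha> V *s e + W \<and> W \<in> h" for V
      using \<alpha>(2) by (intro exI[of _ "V - \<alpha> V *s e"]) (simp add: h_def \<alpha>.diff \<alpha>.scale)
    obtain X' where X: "X = \<alpha> X *s e + X'" "X' \<in> h" using split by blast
    obtain Y' where Y: "Y = \<alpha> Y *s e + Y'" "Y' \<in> h" using split by blast
    obtain Z' where Z: "Z = \<alpha> Z *s e + Z'" "Z' \<in> h" using split by blast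
    define x y z where "x = \<alpha> X" and "y = \<alpha> Y" and "z = \<alpha> Z"
    have XYZ: "X = x *s e + X'" "Y = y *s e + Y'" "Z = z *s e + Z'"
      using X Y Z by (simp_all add: x_def y_def z_def)
    have "cartan X Y Z = x * cartan e Y Z + y * cartan e Z X + z * cartan e X Y"
      unfolding XYZ
      using h0[OF X(2) Y(2) Z(2)] cartan_swap(1)[of X' e Z'] cartan_swap(2)[of e X' Z']
        cartan_cyclic[of e X' Y'] cartan_cyclic[of X' Y' e]
      by (simp add: cartan_simps)
    then show ?thesis by (simp add: x_def y_def z_def cartan_def form_bracket_assoc)
  qed
  moreover have "\<alpha> (bracket X Y) = 0" for X Y
    using Dh bracket_in_derived[of X UNIV Y] by (auto simp: h_def)
  ultimately show thesis using that \<alpha>(1) by blast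
qed

lemma symmetrized_derivation:
  assumes solvable and "dim (UNIV :: 'g set) \<le> 6" and two: "(2 :: 'k) \<noteq> 0"
  shows "\<exists>D. derivation_to_dual D \<and> \<phi> = (\<lambda>X Y. D X Y + dual_transpose D X Y)"
proof -
  obtain \<alpha> e where \<alpha>: "Vector_Spaces.linear scale (*) \<alpha>" "\<And>X Y. \<alpha> (bracket X Y) = 0"
    and cart: "\<And>X Y Z. cartan X Y Z =
       \<alpha> X * \<phi> e (bracket Y Z) + \<alpha> Y * \<phi> e (bracket Z X) + \<alpha> Z * \<phi> e (bracket X Y)"
    using cartan_divisible_by_closed_functional[OF assms(1,2)] by blast
  interpret \<alpha>: Vector_Spaces.linear scale "(*)" \<alpha> by (rule \<alpha>)
  define c :: 'k where "c = inverse 2"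
  have c: "c * x + c * x = x" for x
    using two by (simp add: c_def flip: distrib_left mult_2)
  \<comment> \<open>The \<open>\<alpha>\<close> terms are skew and cancel against the transpose,
    leaving \<open>\<phi>\<close>. As \<open>\<alpha>\<close> kills brackets, the derivation
    identity becomes \<open>c\<close> times the formula \<open>cart\<close>.\<close>
  define D where "D X Y = c * (\<phi> X Y - \<alpha> X * \<phi> e Y + \<alpha> Y * \<phi> e X)" for X Y
  have D_left: "D (X + Y) Z = D X Z + D Y Z" "D (a *s X) Z = a * D X Z" for a X Y Z
    unfolding D_def form_left form_right \<alpha>.add \<alpha>.scale by algebra+
  have D_right: "D X (Y + Z) = D X Y + D X Z" "D X (a *s Y) = a * D X Y" for a X Y Z
    unfolding D_def form_left form_right \<alpha>.add \<alpha>.scale by algebra+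
  have "linear_to_dual D"
    unfolding bilinear_form_def
  proof (intro conjI allI)
    show "Vector_Spaces.linear scale (*) (D X)" for X
      by unfold_locales (auto simp: D_right algebra_simps)
    show "Vector_Spaces.linear scale (*) (\<lambda>X. D X Y)" for Y
      by unfold_locales (auto simp: D_left algebra_simps)
  qed
  moreover have "D (bracket X Y) Z = D X (bracket Y Z) - D Y (bracket X Z)" for X Y Z
  proof -
    have 1: "\<phi> X (bracket Y Z) = cartan X Y Z" "\<phi> (bracket X Y) Z = cartan X Y Z"
      by (simp_all add: cartan_def form_bracket_assoc)
    have 2: "\<phi> Y (bracket X Z) = - cartan X Y Z"
      using invariant[of X Y Z] by (simp add: cartan_def)
    have 3: "\<phi> e (bracket X Z) = - \<phi> e (bracket Z X)"
      using bracket_anticomm[of X Z] by (simp add: form_right)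
    show ?thesis
      unfolding D_def \<alpha>(2) 1 2 3 using cart[of X Y Z] by algebra
  qed
  ultimately have "derivation_to_dual D" by (simp add: derivation_to_dual_def)
  moreover have "\<phi> = (\<lambda>X Y. D X Y + dual_transpose D X Y)"
  proof (intro ext)
    fix X Y
    show "\<phi> X Y = D X Y + dual_transpose D X Y"
    proof -
      have "D X Y + dual_transpose D X Y = c * \<phi> X Y + c * \<phi> X Y"
        unfolding D_def dual_transpose_def symmetric[of Y X] by algebra
      then show ?thesis by (simp add: c)
    qed
  qed
  ultimately show ?thesis by blast
qed

end

section \<open>Passage from maps into the dual to ad-invariant metrics\<close>

context finite_dimensional_lie_algebra
begin

lemma solvable_imp_T_star_solitary:
  assumes solvable "dim (UNIV :: 'g set) \<le> 6" "(2 :: 'k) \<noteq> 0"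
  shows T_star_solitary
  unfolding T_star_solitary_def
proof (intro allI impI)
  fix \<phi> :: "'g \<Rightarrow> 'g \<Rightarrow> 'k"
  assume \<phi>: "linear_to_dual \<phi> \<and> ad_invariant_to_dual \<phi> \<and> \<phi> = dual_transpose \<phi>"
  interpret invariant_symmetric_form scale bracket Basis \<phi>
  proof unfold_locales
    show "bilinear_form \<phi>" using \<phi> by blast
    show "\<phi> (bracket X Y) Z = - \<phi> Y (bracket X Z)" for X Y Z
      using \<phi> by (simp add: ad_invariant_to_dual_def)
    show "\<phi> X Y = \<phi> Y X" for X Y
      using \<phi> unfolding dual_transpose_def by metis
  qed
  show "\<exists>D. derivation_to_dual D \<and> \<phi> = (\<lambda>X Y. D X Y + dual_transpose D X Y)"
    using symmetrized_derivation assms by blast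
qed

text \<open>For nonzero \<open>l\<close>, a dimension count gives a nonzero \<open>z\<close>
  orthogonal to the kernel of \<open>l\<close>. Then \<open>g z\<close> is proportional to
  \<open>l\<close>, with nonzero factor by nondegeneracy, and rescaling \<open>z\<close>
  finishes.\<close>

lemma metric_represents_functional:
  assumes g: "metric g" and lin: "Vector_Spaces.linear scale (*) l"
  shows "\<exists>X. \<forall>Y. g X Y = l Y"
proof (cases "\<forall>Y. l Y = 0")
  case True
  have "Vector_Spaces.linear scale (*) (\<lambda>X. g X Y)" for Y
    using g by (simp add: metric_def bilinear_form_def)
  then have "g 0 Y = 0" for Y
    by (rule module_hom.zero[OF Vector_Spaces.linear.axioms(3)])
  then show ?thesis using True by auto
next
  case False
  then obtain v where v: "l v \<noteq> 0" by auto
  interpret l: Vector_Spaces.linear scale "(*)" l by (rule lin)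
  have gl: "Vector_Spaces.linear scale (*) (\<lambda>X. g X Y)" "Vector_Spaces.linear scale (*) (g X)" for X Y
    using g by (auto simp: metric_def bilinear_form_def)
  define K where "K = {x. l x = 0}"
  have subK: "subspace K" unfolding K_def by (rule l.subspace_kernel)
  obtain B where B: "B \<subseteq> K" "independent B" "K \<subseteq> span B" "card B = dim K"
    using basis_exists[of K] by blast
  have "dim (UNIV :: 'g set) \<le> dim {X \<in> UNIV. \<forall>w\<in>B. g X w = 0} + card B"
    using finiteI_independent[OF B(2)] gl by (intro dim_le_dim_annihilated) auto
  moreover have "dim K < dim (UNIV :: 'g set)"
  proof (rule dim_psubset)
    show "span K \<subset> span UNIV" using v subK by (auto simp: K_def span_eq_iff[THEN iffD2])
  qed
  ultimately have "dim {X \<in> UNIV. \<forall>w\<in>B. g X w = 0} \<noteq> 0" using B(4) by linarith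
  then obtain z where z: "z \<noteq> 0" "\<And>w. w \<in> B \<Longrightarrow> g z w = 0" by auto
  interpret gz: Vector_Spaces.linear scale "(*)" "g z" by (rule gl)
  have "span B \<subseteq> {w. g z w = 0}"
    using z(2) gz.subspace_kernel by (intro span_minimal) auto
  then have gzK: "g z w = 0" if "l w = 0" for w using that B(3) by (auto simp: K_def)
  have gz: "g z Y = l Y / l v * g z v" for Y
  proof -
    have "l (Y - (l Y / l v) *s v) = 0" using v by (simp add: l.diff l.scale)
    then have "g z (Y - (l Y / l v) *s v) = 0" by (rule gzK)
    then show ?thesis by (simp add: gz.diff gz.scale)
  qed
  have nz: "g z v \<noteq> 0"
  proof
    assume "g z v = 0"
    then have "g z Y = 0" for Y using gz[of Y] by simp
    then show False using g z(1) by (auto simp: metric_def)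
  qed
  have "g ((l v / g z v) *s z) Y = l Y" for Y
  proof -
    have "g ((l v / g z v) *s z) Y = l v / g z v * g z Y"
      by (rule module_hom.scale[OF Vector_Spaces.linear.axioms(3)[OF gl(1)]])
    also have "\<dots> = l Y" by (subst gz) (simp add: v nz)
    finally show ?thesis .
  qed
  then show ?thesis by blast
qed

text \<open>Since \<open>adjoint_wrt\<close> is a definite description, existence has to be shown:
  the adjoint at \<open>Y\<close> represents the functional sending \<open>X\<close> to
  \<open>g (f X) Y\<close>. Uniqueness is \<open>adjoint_wrt_eqI\<close>.\<close>

lemma metric_adjoint:
  assumes g: "metric g" and f: "linear_endo f"
  shows "g (f X) Y = g X (adjoint_wrt g f Y)"
proof -
  have "\<exists>W. \<forall>X. g W X = g (f X) Y" for Y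
  proof (rule metric_represents_functional[OF g])
    have "Vector_Spaces.linear scale (*) (\<lambda>X. g X Y)"
      using g by (simp add: metric_def bilinear_form_def)
    from Vector_Spaces.linear_compose[OF f this]
    show "Vector_Spaces.linear scale (*) (\<lambda>X. g (f X) Y)" by (simp add: o_def)
  qed
  then obtain k where k: "\<And>X Y. g (k Y) X = g (f X) Y" by metis
  have "g (f X) Y = g X (k Y)" for X Y
    using k g by (simp add: metric_def)
  then show ?thesis using adjoint_wrt_eqI[OF g, of f k] by simp
qed

text \<open>Composing with \<open>g\<close> turns \<open>\<phi>\<close> into a symmetric
  ad-invariant map \<open>\<psi>\<close> to the dual. A derivation \<open>E\<close> to the dual is
  converted back through \<open>g\<close> into a derivation \<open>D\<close>, and the transpose of
  \<open>E\<close> corresponds to the adjoint of \<open>D\<close>.\<close>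

lemma T_star_solitary_imp_solitary:
  assumes T: T_star_solitary and ad: "ad_invariant_metric g"
  shows "solitary g"
  unfolding solitary_def
proof (intro allI impI)
  fix \<phi> assume \<phi>: "linear_endo \<phi> \<and> ad_invariant_endo \<phi> \<and> adjoint_wrt g \<phi> = \<phi>"
  have g: "metric g" and inv: "g (bracket X Y) Z = - g Y (bracket X Z)" for X Y Z
    using ad by (auto simp: ad_invariant_metric_def)
  have sym: "g X Y = g Y X" for X Y using g by (auto simp: metric_def)
  have gl: "Vector_Spaces.linear scale (*) (\<lambda>X. g X Y)" "Vector_Spaces.linear scale (*) (g X)" for X Y
    using g by (auto simp: metric_def bilinear_form_def)
  have g_left: "g (X + Y) Z = g X Z + g Y Z" "g (X - Y) Z = g X Z - g Y Z"
    "g (c *s X) Z = c * g X Z" "g (- X) Z = - g X Z" for c X Y Z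
    using module_hom.add[OF Vector_Spaces.linear.axioms(3)[OF gl(1)]]
      module_hom.diff[OF Vector_Spaces.linear.axioms(3)[OF gl(1)]]
      module_hom.scale[OF Vector_Spaces.linear.axioms(3)[OF gl(1)]]
      module_hom.neg[OF Vector_Spaces.linear.axioms(3)[OF gl(1)]] by auto
  have eqI: "X = Y" if "\<And>Z. g X Z = g Y Z" for X Y
  proof -
    have "\<forall>Z. g (X - Y) Z = 0" using that by (simp add: g_left)
    then have "X - Y = 0" using g unfolding metric_def by blast
    then show ?thesis by simp
  qed
  have self: "g (\<phi> X) Y = g X (\<phi> Y)" for X Y
    using metric_adjoint[OF g, of \<phi> X Y] \<phi> by simp
  define \<psi> where "\<psi> X Y = g (\<phi> X) Y" for X Y
  have "linear_to_dual \<psi>"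
    unfolding bilinear_form_def
  proof (intro conjI allI)
    show "Vector_Spaces.linear scale (*) (\<psi> X)" for X
      unfolding \<psi>_def by (rule gl)
    show "Vector_Spaces.linear scale (*) (\<lambda>X. \<psi> X Y)" for Y
      using Vector_Spaces.linear_compose[OF _ gl(1), of scale \<phi> Y] \<phi> by (simp add: \<psi>_def o_def)
  qed
  moreover have "ad_invariant_to_dual \<psi>"
    using \<phi> by (simp add: ad_invariant_to_dual_def ad_invariant_endo_def \<psi>_def inv)
  moreover have "\<psi> = dual_transpose \<psi>"
  proof (intro ext)
    show "\<psi> X Y = dual_transpose \<psi> X Y" for X Y
      using self[of X Y] sym[of X "\<phi> Y"] by (simp add: \<psi>_def dual_transpose_def)
  qed
  ultimately obtain E where E: "derivation_to_dual E" "\<psi> = (\<lambda>X Y. E X Y + dual_transpose E X Y)"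
    using T unfolding T_star_solitary_def by blast
  have El: "Vector_Spaces.linear scale (*) (E X)" "Vector_Spaces.linear scale (*) (\<lambda>X. E X Y)" for X Y
    using E(1) by (auto simp: derivation_to_dual_def bilinear_form_def)
  have "\<exists>W. \<forall>Y. g W Y = E X Y" for X
    using metric_represents_functional[OF g El(1)] by blast
  then obtain D where D: "\<And>X Y. g (D X) Y = E X Y" by metis
  have linD: "linear_endo D"
  proof unfold_locales
    show "D (X + Y) = D X + D Y" for X Y
      by (rule eqI) (simp add: g_left D
          module_hom.add[OF Vector_Spaces.linear.axioms(3)[OF El(2)]])
    show "D (c *s X) = c *s D X" for c X
      by (rule eqI) (simp add: g_left D
          module_hom.scale[OF Vector_Spaces.linear.axioms(3)[OF El(2)]])
  qed
  have "D (bracket X Y) = bracket (D X) Y + bracket X (D Y)" for X Y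
  proof (rule eqI)
    fix Z
    have "g (D (bracket X Y)) Z = g (D X) (bracket Y Z) - g (D Y) (bracket X Z)"
      using E(1) by (simp add: D derivation_to_dual_def)
    also have "\<dots> = g (- bracket Y (D X)) Z + g (bracket X (D Y)) Z"
      by (simp add: inv g_left)
    also have "- bracket Y (D X) = bracket (D X) Y" by (rule bracket_anticomm[symmetric])
    finally show "g (D (bracket X Y)) Z = g (bracket (D X) Y + bracket X (D Y)) Z"
      by (simp add: g_left)
  qed
  then have "derivation D" using linD by (simp add: derivation_def)
  moreover have "\<phi> = (\<lambda>X. D X + adjoint_wrt g D X)"
  proof
    fix X
    show "\<phi> X = D X + adjoint_wrt g D X"
    proof (rule eqI)
      fix Y
      have "g (\<phi> X) Y = E X Y + E Y X"
        using fun_cong[OF fun_cong[OF E(2)], of X Y] by (simp add: \<psi>_def dual_transpose_def)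
      also have "\<dots> = g (D X) Y + g (D Y) X" by (simp add: D)
      also have "g (D Y) X = g (adjoint_wrt g D X) Y"
        using metric_adjoint[OF g linD, of Y X] sym by simp
      finally show "g (\<phi> X) Y = g (D X + adjoint_wrt g D X) Y" by (simp add: g_left)
    qed
  qed
  ultimately show "\<exists>D. derivation D \<and> \<phi> = (\<lambda>X. D X + adjoint_wrt g D X)" by blast
qed

end

text \<open>Stated outside the locales over any field where \<open>2\<close> is nonzero, so that the
  real and complex cases are both instances.\<close>

lemma solvable_dim_le_six_solitary:
  fixes scale :: "'k::field \<Rightarrow> 'g::ab_group_add \<Rightarrow> 'g"
  assumes "lie_algebra scale bracket" "lie_algebra.solvable scale bracket"
    "finite_dimensional_vector_space scale B" "vector_space.dim scale UNIV \<le> 6" "(2 :: 'k) \<noteq> 0"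
  shows "lie_algebra.T_star_solitary scale bracket"
    "lie_algebra.ad_invariant_metric scale bracket g \<Longrightarrow> lie_algebra.solitary scale bracket g"
proof -
  interpret finite_dimensional_lie_algebra scale bracket B
    using assms(1,3) by (rule finite_dimensional_lie_algebra.intro)
  show T: T_star_solitary
    using solvable_imp_T_star_solitary assms by blast
  show "solitary g" if "ad_invariant_metric g"
    using T_star_solitary_imp_solitary[OF T that] .
qed

theorem proposition7p3:
  fixes scR :: "real \<Rightarrow> 'a::ab_group_add \<Rightarrow> 'a" and brR :: "'a \<Rightarrow> 'a \<Rightarrow> 'a"
    and scC :: "complex \<Rightarrow> 'b::ab_group_add \<Rightarrow> 'b" and brC :: "'b \<Rightarrow> 'b \<Rightarrow> 'b"
  shows
    "(lie_algebra scR brR \<and> lie_algebra.solvable scR brR \<and>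
      (\<exists>B. finite_dimensional_vector_space scR B) \<and> vector_space.dim scR UNIV \<le> 6 \<longrightarrow>
        lie_algebra.T_star_solitary scR brR \<and>
        (\<forall>g. lie_algebra.ad_invariant_metric scR brR g \<longrightarrow> lie_algebra.solitary scR brR g)) \<and>
     (lie_algebra scC brC \<and> lie_algebra.solvable scC brC \<and>
      (\<exists>B. finite_dimensional_vector_space scC B) \<and> vector_space.dim scC UNIV \<le> 6 \<longrightarrow>
        lie_algebra.T_star_solitary scC brC \<and>
        (\<forall>g. lie_algebra.ad_invariant_metric scC brC g \<longrightarrow> lie_algebra.solitary scC brC g))"
  using solvable_dim_le_six_solitary[of scR brR] solvable_dim_le_six_solitary[of scC brC]
  by auto

end
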